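(* Consider the pessimistic multi-leader multi-follower game $\underline{\mathscr{E}}$ and suppose that the objectives $\{\varphi_i\}_{i\in\mathcal{N}}$ of the leaders admit a quasi-potential function $\pi+h$. If $(x,w)$ is a solution of $$\underline{\mathrm{P}}^{\rm quasi}:\qquad \min_{x}\ \max_{w}\ \pi(x)+h(x,w)\quad\text{subject to}\quad x\in X,\ w\in\mathcal{S}(x),$$ then $(x,y)$, where $y=(y_1,\dots,y_N)$ with $y_i=w$ for all $i\in\mathcal{N}$, is an equilibrium of $\underline{\mathscr{E}}$. Consequently, if $\underline{\mathrm{P}}^{\rm quasi}$ admits a solution, then $\underline{\mathscr{E}}$ admits an equilibrium.
   Context: Setting: $\mathcal{N}=\{1,\dots,N\}$ is the set of leaders. Leader $i$ has a convex compact strategy set $X_i\subseteq\mathbb{R}^{m_i}$; $X=\prod_{i=1}^N X_i$. For $x=(x_1,\dots,x_N)$, $x^{-i}$ denotes $(x_1,\dots,x_{i-1},x_{i+1},\dots,x_N)$ and $(\bar x_i,x^{-i})$ denotes $x$ with $i$-th component replaced by $\bar x_i$. $Y$ is the ambient Euclidean space of follower strategy profiles. For each $x\in X$, the set of follower equilibria is $\mathcal{S}(x)\subseteq Y$, the (possibly multivalued) solution set of the variational inequality $\mathrm{VI}(G(x,\cdot),K(x))$, i.e. $\mathcal{S}(x)=\{y\in K(x): G(x,y)^\top(z-y)\ge 0\ \ \forall z\in K(x)\}$, where $K$ is a continuous set-valued map with closed convex values in $Y$ and $G$ is a continuous map of all its variables. Leader $i$ has a continuous objective $\varphi_i$ on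 $X\times Y$, written $\varphi_i(x_i,y_i;x^{-i})$. Pessimistic game $\underline{\mathscr{E}}$: leader $i$ solves $$\underline{\mathrm{L}}_i(x^{-i}):\quad \min_{x_i}\ \max_{y_i}\ \varphi_i(x_i,y_i;x^{-i})\quad\text{s.t. } x_i\in X_i,\ y_i\in\mathcal{S}(x).$$ An equilibrium of $\underline{\mathscr{E}}$ is a Nash equilibrium of the game in which the leaders solve $\{\underline{\mathrm{L}}_i\}_{i\in\mathcal{N}}$, i.e. a point $(x,y)$ such that $(x_i,y_i)$ solves $\underline{\mathrm{L}}_i(x^{-i})$ for every $i$. Meaning of solution of a min-max problem: $(x_i,y_i)$ solves $\underline{\mathrm{L}}_i(x^{-i})$ if $x_i\in X_i$, $y_i\in\mathcal{S}(x)$ attains $\max_{v\in\mathcal{S}(x)}\varphi_i(x_i,v;x^{-i})$, and $\varphi_i(x_i,y_i;x^{-i})\le\sup_{v\in\mathcal{S}(\bar x_i,x^{-i})}\varphi_i(\bar x_i,v;x^{-i})$ for all $\bar x_i\in X_i$ with $\mathcal{S}(\bar x_i,x^{-i})\neq\emptyset$. Likewise $(x,w)$ solves $\underline{\mathrm{P}}^{\rm quasi}$ if $x\in X$, $w\in\mathcal{S}(x)$ attains $\max_{v\in\mathcal{S}(x)}h(x,v)$, and $\pi(x)+h(x,w)\le\pi(x')+\sup_{w'\in\mathcal{S}(x')}h(x',w')$ for all $x'\in X$ with $\mathcal{S}(x')\ne\emptyset$. (Suprema may equal $+\infty$.) Quasi-potential function: the objectives $\{\varphi_i\}$ admit a quasi-potential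 function $\pi+h$ if (i) there exist real-valued functions $\phi_1(x),\dots,\phi_N(x)$ on $X$ and a real-valued function $h$ on $X\times Y$ (the same for all leaders) such that $\varphi_i(x_i,y_i;x^{-i})=\phi_i(x)+h(x,y_i)$ for each $i$; and (ii) there is a function $\pi$ on $X$ such that for all $i$, all $x\in X$ and all $x_i'\in X_i$, $\phi_i(x_i;x^{-i})-\phi_i(x_i';x^{-i})=\pi(x_i;x^{-i})-\pi(x_i';x^{-i})$. *)

theory Defs
  imports "HOL-Analysis.Analysis"
begin

text \<open>
  The leaders are \<open>{1..N}\<close>. The strategy space of leader \<open>i\<close> is the library's
  \<open>Euclidean_space (m i)\<close>, whose points are the sequences \<open>nat \<Rightarrow> real\<close> that vanish from
  index \<open>m i\<close> on; in this way the dimension may differ from leader to leader.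
  A profile is an element of the extensional product \<open>Pi\<^sub>E {1..N} X\<close>, and the point with
  \<open>i\<close>-th component replaced is \<open>x(i := u)\<close>.
  The ambient space of follower strategy profiles is a type \<open>'y\<close> of class
  \<open>euclidean_space\<close>.
\<close>

type_synonym profile = "nat \<Rightarrow> nat \<Rightarrow> real"

abbreviation profiles :: "nat \<Rightarrow> (nat \<Rightarrow> (nat \<Rightarrow> real) set) \<Rightarrow> profile set" where
  "profiles N X \<equiv> Pi\<^sub>E {1..N} X"

definition profile_topology ::
    "nat \<Rightarrow> (nat \<Rightarrow> nat) \<Rightarrow> (nat \<Rightarrow> (nat \<Rightarrow> real) set) \<Rightarrow> profile topology" where
  "profile_topology N m X =
     subtopology (product_topology (\<lambda>i. Euclidean_space (m i)) {1..N}) (profiles N X)"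

text \<open>The constant \<open>convex\<close> does not apply, as functions are not an instance of
  \<open>real_vector\<close>.\<close>

definition convex_seqs :: "(nat \<Rightarrow> real) set \<Rightarrow> bool" where
  "convex_seqs C \<longleftrightarrow>
     (\<forall>a\<in>C. \<forall>b\<in>C. \<forall>s\<ge>0. \<forall>t\<ge>0. s + t = 1 \<longrightarrow> (\<lambda>k. s * a k + t * b k) \<in> C)"

text \<open>Continuity of a set-valued map: upper and lower semicontinuity.\<close>

definition continuous_set_valued ::
    "'a topology \<Rightarrow> 'b topology \<Rightarrow> ('a \<Rightarrow> 'b set) \<Rightarrow> bool" where
  "continuous_set_valued S T F \<longleftrightarrow>
     (\<forall>x\<in>topspace S. F x \<subseteq> topspace T) \<and>
     (\<forall>U. openin T U \<longrightarrow> openin S {x \<in> topspace S. F x \<subseteq> U}) \<and>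
     (\<forall>U. openin T U \<longrightarrow> openin S {x \<in> topspace S. F x \<inter> U \<noteq> {}})"

definition VI_solutions :: "('y::euclidean_space \<Rightarrow> 'y) \<Rightarrow> 'y set \<Rightarrow> 'y set" where
  "VI_solutions F C = {y \<in> C. \<forall>z\<in>C. F y \<bullet> (z - y) \<ge> 0}"

definition follower_equilibria ::
    "(profile \<Rightarrow> 'y::euclidean_space \<Rightarrow> 'y) \<Rightarrow> (profile \<Rightarrow> 'y set) \<Rightarrow> profile \<Rightarrow> 'y set" where
  "follower_equilibria G K x = VI_solutions (G x) (K x)"

text \<open>
  In what follows \<open>\<phi> i x v\<close> stands for \<open>\<phi>\<^sub>i(x\<^sub>i, v; x\<^sup>-\<^sup>i)\<close>.
  The pair \<open>(u, v)\<close> solves the problem of leader \<open>i\<close> when the rivals play as in \<open>x\<close>;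
  the component \<open>x i\<close> plays no role. The inner suprema are taken in the extended reals.
\<close>

definition solves_pessimistic_leader ::
    "(nat \<Rightarrow> (nat \<Rightarrow> real) set) \<Rightarrow> (profile \<Rightarrow> 'y set) \<Rightarrow> (nat \<Rightarrow> profile \<Rightarrow> 'y \<Rightarrow> real)
      \<Rightarrow> nat \<Rightarrow> profile \<Rightarrow> (nat \<Rightarrow> real) \<Rightarrow> 'y \<Rightarrow> bool" where
  "solves_pessimistic_leader X S \<phi> i x u v \<longleftrightarrow>
     u \<in> X i \<and> v \<in> S (x(i := u)) \<and>
     (\<forall>v'\<in>S (x(i := u)). \<phi> i (x(i := u)) v' \<le> \<phi> i (x(i := u)) v) \<and>
     (\<forall>u'\<in>X i. S (x(i := u')) \<noteq> {} \<longrightarrow>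
        ereal (\<phi> i (x(i := u)) v) \<le> (SUP v'\<in>S (x(i := u')). ereal (\<phi> i (x(i := u')) v')))"

definition pessimistic_equilibrium ::
    "nat \<Rightarrow> (nat \<Rightarrow> (nat \<Rightarrow> real) set) \<Rightarrow> (profile \<Rightarrow> 'y set) \<Rightarrow> (nat \<Rightarrow> profile \<Rightarrow> 'y \<Rightarrow> real)
      \<Rightarrow> profile \<Rightarrow> (nat \<Rightarrow> 'y) \<Rightarrow> bool" where
  "pessimistic_equilibrium N X S \<phi> x y \<longleftrightarrow>
     x \<in> profiles N X \<and> y \<in> Pi\<^sub>E {1..N} (\<lambda>_. UNIV) \<and>
     (\<forall>i\<in>{1..N}. solves_pessimistic_leader X S \<phi> i x (x i) (y i))"

definition quasi_potential ::
    "nat \<Rightarrow> (nat \<Rightarrow> (nat \<Rightarrow> real) set) \<Rightarrow> (nat \<Rightarrow> profile \<Rightarrow> 'y \<Rightarrow> real)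
      \<Rightarrow> (profile \<Rightarrow> real) \<Rightarrow> (profile \<Rightarrow> 'y \<Rightarrow> real) \<Rightarrow> bool" where
  "quasi_potential N X \<phi> \<pi> h \<longleftrightarrow>
     (\<exists>\<psi> :: nat \<Rightarrow> profile \<Rightarrow> real.
        (\<forall>i\<in>{1..N}. \<forall>x\<in>profiles N X. \<forall>v. \<phi> i x v = \<psi> i x + h x v) \<and>
        (\<forall>i\<in>{1..N}. \<forall>x\<in>profiles N X. \<forall>u\<in>X i.
           \<psi> i x - \<psi> i (x(i := u)) = \<pi> x - \<pi> (x(i := u))))"

definition solves_pessimistic_quasi ::
    "nat \<Rightarrow> (nat \<Rightarrow> (nat \<Rightarrow> real) set) \<Rightarrow> (profile \<Rightarrow> 'y set)
      \<Rightarrow> (profile \<Rightarrow> real) \<Rightarrow> (profile \<Rightarrow> 'y \<Rightarrow> real) \<Rightarrow> profile \<Rightarrow> 'y \<Rightarrow> bool" where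
  "solves_pessimistic_quasi N X S \<pi> h x w \<longleftrightarrow>
     x \<in> profiles N X \<and> w \<in> S x \<and>
     (\<forall>v\<in>S x. h x v \<le> h x w) \<and>
     (\<forall>x'\<in>profiles N X. S x' \<noteq> {} \<longrightarrow>
        ereal (\<pi> x + h x w) \<le> ereal (\<pi> x') + (SUP w'\<in>S x'. ereal (h x' w')))"

end

theory Submission
  imports Defs
begin

text \<open>
  Fix the rivals of leader \<open>i\<close> at a solution \<open>(x, w)\<close> of the quasi-potential problem. Along every
  unilateral deviation the objective of the leader differs from \<open>\<pi> + h\<close> by one constant,
  \<open>\<psi> i x - \<pi> x\<close> (lemma \<open>quasi_potential_shift\<close>). This constant depends neither on the deviation nor
  on the follower strategy, so it passes through the inner supremum, and the worst-case value of the
  leader is the worst-case value of \<open>\<pi> + h\<close> up to the same constant. Since the unilateral deviations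
  are among the competitors in the quasi-potential problem, optimality there gives optimality for
  each leader. A single \<open>w\<close> serves all leaders because \<open>h\<close>, the only part of the objectives that
  sees the follower strategy, is common to them: a maximiser of \<open>h x\<close> over \<open>S x\<close> is a maximiser of
  every \<open>\<phi> i x\<close>.
\<close>

lemma fun_upd_in_PiE:
  assumes "x \<in> Pi\<^sub>E I X" "i \<in> I" "u \<in> X i"
  shows "x(i := u) \<in> Pi\<^sub>E I X"
  using assms by (auto simp: PiE_iff extensional_def)

text \<open>
  The case \<open>u = x i\<close> covers \<open>x\<close> itself, so the current profile and all deviations share one constant
  and their values can be compared.
\<close>

lemma quasi_potential_shift:
  assumes "quasi_potential N X \<phi> \<pi> h" "x \<in> profiles N X" "i \<in> {1..N}"
  obtains c where
    "\<And>u v. u \<in> X i \<Longrightarrow> \<phi> i (x(i := u)) v = c + (\<pi> (x(i := u)) + h (x(i := u)) v)"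
proof -
  obtain \<psi> where
    \<phi>: "\<And>z v. z \<in> profiles N X \<Longrightarrow> \<phi> i z v = \<psi> i z + h z v" and
    \<psi>: "\<And>u. u \<in> X i \<Longrightarrow> \<psi> i x - \<psi> i (x(i := u)) = \<pi> x - \<pi> (x(i := u))"
    using assms unfolding quasi_potential_def by blast
  show thesis
  proof (rule that)
    fix u v assume u: "u \<in> X i"
    show "\<phi> i (x(i := u)) v = (\<psi> i x - \<pi> x) + (\<pi> (x(i := u)) + h (x(i := u)) v)"
      using \<phi>[OF fun_upd_in_PiE[OF assms(2,3) u], of v] \<psi>[OF u] by linarith
  qed
qed

lemma SUP_ereal_const_add:
  assumes "A \<noteq> {}"
  shows "(SUP v\<in>A. ereal (c + f v)) = ereal c + (SUP v\<in>A. ereal (f v))"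
  using SUP_ereal_add_right[of A "ereal c" "\<lambda>v. ereal (f v)"] assms by simp

lemma solves_quasi_imp_solves_leader:
  assumes sol: "solves_pessimistic_quasi N X S \<pi> h x w"
    and qp: "quasi_potential N X \<phi> \<pi> h"
    and i: "i \<in> {1..N}"
  shows "solves_pessimistic_leader X S \<phi> i x (x i) w"
proof -
  have x: "x \<in> profiles N X" and w: "w \<in> S x" and w_max: "\<And>v. v \<in> S x \<Longrightarrow> h x v \<le> h x w"
    and opt: "\<And>z. z \<in> profiles N X \<Longrightarrow> S z \<noteq> {} \<Longrightarrow>
        ereal (\<pi> x + h x w) \<le> ereal (\<pi> z) + (SUP v\<in>S z. ereal (h z v))"
    using sol unfolding solves_pessimistic_quasi_def by blast+
  have xi: "x i \<in> X i"
    using x i by (rule PiE_mem)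
  obtain c where shift:
    "\<And>u v. u \<in> X i \<Longrightarrow> \<phi> i (x(i := u)) v = c + (\<pi> (x(i := u)) + h (x(i := u)) v)"
    using quasi_potential_shift[OF qp x i] by blast
  have shift_x: "\<phi> i x v = c + (\<pi> x + h x v)" for v
    using shift[OF xi, of v] by simp
  have "ereal (\<phi> i x w) \<le> (SUP v\<in>S (x(i := u)). ereal (\<phi> i (x(i := u)) v))"
    if u: "u \<in> X i" and ne: "S (x(i := u)) \<noteq> {}" for u
  proof -
    let ?z = "x(i := u)"
    have "ereal (\<phi> i x w) = ereal c + ereal (\<pi> x + h x w)"
      by (simp add: shift_x)
    also have "\<dots> \<le> ereal c + (ereal (\<pi> ?z) + (SUP v\<in>S ?z. ereal (h ?z v)))"
      using opt[OF fun_upd_in_PiE[OF x i u] ne] by (rule add_left_mono)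
    also have "\<dots> = (SUP v\<in>S ?z. ereal (c + (\<pi> ?z + h ?z v)))"
      by (simp only: SUP_ereal_const_add[OF ne])
    also have "\<dots> = (SUP v\<in>S ?z. ereal (\<phi> i ?z v))"
      by (simp only: shift[OF u])
    finally show ?thesis .
  qed
  then show ?thesis
    unfolding solves_pessimistic_leader_def using xi w w_max by (simp add: shift_x)
qed

lemma solves_quasi_imp_equilibrium:
  assumes "solves_pessimistic_quasi N X S \<pi> h x w" and "quasi_potential N X \<phi> \<pi> h"
  shows "pessimistic_equilibrium N X S \<phi> x (\<lambda>i\<in>{1..N}. w)"
proof -
  have "x \<in> profiles N X"
    using assms(1) unfolding solves_pessimistic_quasi_def by blast
  then show ?thesis
    unfolding pessimistic_equilibrium_def
    using solves_quasi_imp_solves_leader[OF assms] by simp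
qed

theorem mainTheorem3:
  fixes N :: nat
    and m :: "nat \<Rightarrow> nat"
    and X :: "nat \<Rightarrow> (nat \<Rightarrow> real) set"
    and G :: "profile \<Rightarrow> 'y::euclidean_space \<Rightarrow> 'y"
    and K :: "profile \<Rightarrow> 'y set"
    and \<phi> :: "nat \<Rightarrow> profile \<Rightarrow> 'y \<Rightarrow> real"
    and \<pi> :: "profile \<Rightarrow> real"
    and h :: "profile \<Rightarrow> 'y \<Rightarrow> real"
  assumes X_compact: "\<And>i. i \<in> {1..N} \<Longrightarrow> compactin (Euclidean_space (m i)) (X i)"
    and X_convex: "\<And>i. i \<in> {1..N} \<Longrightarrow> convex_seqs (X i)"
    and K_continuous: "continuous_set_valued (profile_topology N m X) euclidean K"
    and K_closed: "\<And>x. x \<in> profiles N X \<Longrightarrow> closed (K x)"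
    and K_convex: "\<And>x. x \<in> profiles N X \<Longrightarrow> convex (K x)"
    and G_continuous:
      "continuous_map (prod_topology (profile_topology N m X) euclidean) euclidean
         (\<lambda>(x, y). G x y)"
    and \<phi>_continuous:
      "\<And>i. i \<in> {1..N} \<Longrightarrow>
         continuous_map (prod_topology (profile_topology N m X) euclidean) euclideanreal
           (\<lambda>(x, v). \<phi> i x v)"
    and quasi_potential: "quasi_potential N X \<phi> \<pi> h"
  shows "(\<forall>x w. solves_pessimistic_quasi N X (follower_equilibria G K) \<pi> h x w \<longrightarrow>
            pessimistic_equilibrium N X (follower_equilibria G K) \<phi> x (\<lambda>i\<in>{1..N}. w)) \<and>
         ((\<exists>x w. solves_pessimistic_quasi N X (follower_equilibria G K) \<pi> h x w) \<longrightarrow>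
            (\<exists>x y. pessimistic_equilibrium N X (follower_equilibria G K) \<phi> x y))"
  using solves_quasi_imp_equilibrium[OF _ quasi_potential] by blast

end
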